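(* Let $$A(z)=\prod_{i=+\infty}^{-\infty}g_i(z)^{\check\alpha_i}\,e^{\frac{\Lambda_i(z)}{g_i(z)}e_i},\qquad g_i(z)=\zeta_i\frac{Q_i^+(qz)}{Q_i^+(z)},$$ and $Z=\prod_i\zeta_i^{\check\alpha_i}$. Then the $q$-gauge transformation $v(z)$ which diagonalizes the $q$-connection, $$A(z)=v(qz)\,Z\,v(z)^{-1},$$ reads $$v(z)=\prod_{i=-\infty}^{+\infty}Q_i^+(z)^{\check\alpha_i}\cdot\prod_{i=-\infty}^{+\infty}V_i(z),\qquad V_i(z)=\exp\Bigl(-\sum_{j\ge i}\phi_{i,\dots,j}(z)\,e_{i,\dots,j}\Bigr),$$ in which $e_{i,\dots,j}=[\dots[[e_i,e_{i+1}],e_{i+2}]\dots e_j]$ and the functions $\phi_{i,\dots,j}(z)$ satisfy the relations $$\xi_{i+1}\,\phi_i(z)-\xi_i\,\phi_i(qz)=\rho_i(z),$$ $$\xi_{i+2}\,\phi_{i,i+1}(z)-\xi_i\,\phi_{i,i+1}(qz)=\rho_{i+1}(z)\,\phi_i(z),$$ $$\dots$$ $$\xi_{i+j+1}\,\phi_{i,\dots,i+j}(z)-\xi_i\,\phi_{i,\dots,i+j}(qz)=\rho_{i+j}(z)\,\phi_{i,\dots,i+j-1}(z),$$ $$\dots$$ for $i\in\mathbb{Z}$, $j\in\mathbb{Z}_+$.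
   Context: $q\in\mathbb{C}^\times$ is not a root of unity. For $i\in\mathbb{Z}$, $\Lambda_i(z)$ are non-constant polynomials (their roots accumulating only at $0$ or $\infty$), $Q_i^+(z)$ are monic polynomials, $\zeta_i\in\mathbb{C}^\times$, and $\xi_i=\zeta_i/\zeta_{i-1}$; it is assumed that $\xi_i$ and $\xi_{i+1}$ are $q$-distinct, i.e. $\xi_i/\xi_{i+1}\notin q^{\mathbb{Z}}$, for all $i$. The displayed $A(z)$ is the form of the $q$-connection of a nondegenerate $Z$-twisted Miura-Plücker $(\overline{GL}(\infty),q)$-oper with regular singularities determined by the $\Lambda_i$. Notation: $\phi_{i,\dots,j}(z)=Q^-_{i,\dots,j}(z)/Q^+_j(z)$ with $Q^-_{i,\dots,j}$ polynomials (for $j=i$, $\phi_i=Q_i^-/Q_i^+$ and $e_{i,\dots,j}=e_i$), and $$\rho_i(z)=\Lambda_i(z)\frac{Q^+_{i-1}(qz)\,Q^+_{i+1}(z)}{Q^+_i(z)\,Q^+_i(qz)} .$$ Matrices are indexed by $\mathbb{Z}\times\mathbb{Z}$; $\check\alpha_i=E_{ii}-E_{i+1,i+1}$, $e_i=E_{i,i+1}$. $\overline{GL}(\infty)$ is the group of matrices with finitely many nonzero entries below the diagonal and arbitrary entries on and above it (nonzero on the diagonal); $v(z)$ lies in $\overline{B}_+(z)$, the upper triangular matrices with entries in $\mathbb{C}(z)$ and nonzero diagonal entries. A product $\prod_iu_i^{\check\alpha_i}$ denotes the diagonal matrix with $(i,i)$ entry $u_i/u_{i-1}$. In $\prod_{i=+\infty}^{-\infty}$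 larger $i$ stands to the left, so $A(z)$ has diagonal entries $g_i/g_{i-1}$, superdiagonal entries $\Lambda_i$ and zeros elsewhere; in $\prod_{i=-\infty}^{+\infty}$ smaller $i$ stands to the left.
   Formalization: The printed relations fail; proved with ξ_i φ_{i..j}(z) − ξ_{j+1} φ_{i..j}(qz) = ρ_j(z) φ_{i..j−1}(qz) (ξ's exchanged, φ shifted). For given polynomials Q^-, v diagonalizes iff these hold; any diagonalizing v has this form with rational φ, up to a constant diagonal right factor. *)

theory Defs
  imports
    "HOL-Analysis.Elementary_Topology"
    "HOL-Computational_Algebra.Computational_Algebra"
    "HOL-Library.Groups_Big_Fun"
begin

section \<open>The field of rational functions and the \<open>q\<close>-shift\<close>

type_synonym ratfun = "complex poly fract"

definition rconst :: "complex \<Rightarrow> ratfun" where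
  "rconst c = to_fract [:c:]"

text \<open>\<open>f(z) \<mapsto> f(qz)\<close>, substituted into numerator and denominator; for \<open>q \<noteq> 0\<close> this is
  independent of the representation, see \<open>qshift_Fract\<close>.\<close>

definition qshift :: "complex \<Rightarrow> ratfun \<Rightarrow> ratfun" where
  "qshift q f = (THE g. \<exists>a b. b \<noteq> 0 \<and> f = Fract a b \<and>
     g = Fract (pcompose a [:0, q:]) (pcompose b [:0, q:]))"

lemma qshift_Fract:
  assumes "q \<noteq> 0" "b \<noteq> 0"
  shows "qshift q (Fract a b) = Fract (pcompose a [:0, q:]) (pcompose b [:0, q:])"
proof -
  have nz: "pcompose p [:0, q:] \<noteq> 0" if "p \<noteq> 0" for p :: "complex poly"
    using that assms(1) by (simp add: pcompose_eq_0_iff)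
  have "Fract (pcompose c [:0, q:]) (pcompose d [:0, q:]) =
        Fract (pcompose a [:0, q:]) (pcompose b [:0, q:])"
    if "d \<noteq> 0" "Fract a b = Fract c d" for c d
  proof -
    have "a * d = c * b"
      using that assms(2) by (simp add: eq_fract)
    then have "pcompose c [:0, q:] * pcompose b [:0, q:] = pcompose a [:0, q:] * pcompose d [:0, q:]"
      by (metis pcompose_mult)
    then show ?thesis
      using nz[OF that(1)] nz[OF assms(2)] by (simp add: eq_fract)
  qed
  then show ?thesis
    using assms(2) unfolding qshift_def by (intro the_equality) blast+
qed


section \<open>Matrices indexed by the integers\<close>

type_synonym 'a zmat = "int \<Rightarrow> int \<Rightarrow> 'a"

text \<open>The sum ranges over the indices with non-zero summand; there are finitely many of them
  whenever both factors have finitely many non-zero entries below the diagonal.\<close>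

definition mmult :: "'a::semiring_1 zmat \<Rightarrow> 'a zmat \<Rightarrow> 'a zmat"  (infixl \<open>\<star>\<close> 70) where
  "M \<star> N = (\<lambda>a b. Sum_any (\<lambda>k. M a k * N k b))"

definition mdiag :: "(int \<Rightarrow> 'a::zero) \<Rightarrow> 'a zmat" where
  "mdiag d = (\<lambda>a b. if a = b then d a else 0)"

definition mone :: "'a::zero_neq_one zmat" where
  "mone = mdiag (\<lambda>_. 1)"

definition munit :: "int \<Rightarrow> int \<Rightarrow> 'a::zero_neq_one zmat" where
  "munit k l = (\<lambda>a b. if a = k \<and> b = l then 1 else 0)"

definition mscale :: "'a::times \<Rightarrow> 'a zmat \<Rightarrow> 'a zmat" where
  "mscale c M = (\<lambda>a b. c * M a b)"

definition mcommutator :: "'a::ring_1 zmat \<Rightarrow> 'a zmat \<Rightarrow> 'a zmat" where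
  "mcommutator M N = (\<lambda>a b. (M \<star> N) a b - (N \<star> M) a b)"

primrec mpow :: "'a::semiring_1 zmat \<Rightarrow> nat \<Rightarrow> 'a zmat" where
  "mpow M 0 = mone"
| "mpow M (Suc n) = M \<star> mpow M n"

text \<open>For strictly upper triangular \<open>N\<close> each entry of the exponential series is a finite sum.\<close>

definition mexp :: "'a::field zmat \<Rightarrow> 'a zmat" where
  "mexp N = (\<lambda>a b. Sum_any (\<lambda>n. mpow N n a b / of_nat (fact n)))"

definition mprod :: "'a::semiring_1 zmat list \<Rightarrow> 'a zmat" where
  "mprod Ms = foldr (\<star>) Ms mone"

text \<open>Two-sided infinite ordered products: each entry of the finite products over
  \<open>m, \<dots>, n\<close> is eventually constant as \<open>m \<rightarrow> -\<infinity>\<close> and \<open>n \<rightarrow> \<infinity>\<close>.  In the increasing product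
  smaller indices stand to the left, in the decreasing one larger indices do.\<close>

definition has_prod_increasing :: "(int \<Rightarrow> 'a::semiring_1 zmat) \<Rightarrow> 'a zmat \<Rightarrow> bool" where
  "has_prod_increasing F P \<longleftrightarrow>
     (\<forall>a b. \<exists>K. \<forall>m n. m \<le> - K \<and> K \<le> n \<longrightarrow> mprod (map F [m..n]) a b = P a b)"

definition has_prod_decreasing :: "(int \<Rightarrow> 'a::semiring_1 zmat) \<Rightarrow> 'a zmat \<Rightarrow> bool" where
  "has_prod_decreasing F P \<longleftrightarrow>
     (\<forall>a b. \<exists>K. \<forall>m n. m \<le> - K \<and> K \<le> n \<longrightarrow> mprod (map F (rev [m..n])) a b = P a b)"

definition Bplus :: "'a::zero zmat set" where
  "Bplus = {v. (\<forall>a. v a a \<noteq> 0) \<and> (\<forall>a b. b < a \<longrightarrow> v a b = 0)}"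

definition mqshift :: "complex \<Rightarrow> ratfun zmat \<Rightarrow> ratfun zmat" where
  "mqshift q M = (\<lambda>a b. qshift q (M a b))"

text \<open>\<open>u ^ \<alpha>\<^sub>i\<close> for the single coroot \<open>\<alpha>\<^sub>i = E\<^sub>i\<^sub>,\<^sub>i - E\<^sub>i\<^sub>+\<^sub>1\<^sub>,\<^sub>i\<^sub>+\<^sub>1\<close>, and the product
  over all \<open>i\<close> of \<open>u\<^sub>i ^ \<alpha>\<^sub>i\<close>.\<close>

definition coroot_power :: "int \<Rightarrow> 'a::field \<Rightarrow> 'a zmat" where
  "coroot_power i u = mdiag (\<lambda>a. if a = i then u else if a = i + 1 then inverse u else 1)"

definition coroot_prod :: "(int \<Rightarrow> 'a::field) \<Rightarrow> 'a zmat" where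
  "coroot_prod u = mdiag (\<lambda>a. u a / u (a - 1))"

definition simple_root :: "int \<Rightarrow> 'a::zero_neq_one zmat" where
  "simple_root i = munit i (i + 1)"

text \<open>Segments \<open>i, \<dots>, i + n\<close> are encoded by their left end \<open>i\<close> and the number \<open>n\<close>; so
  \<open>root_vec i n\<close> is the iterated commutator \<open>e\<^sub>i\<^sub>,\<^sub>\<dots>\<^sub>,\<^sub>i\<^sub>+\<^sub>n\<close>, and
  below \<open>\<phi> i n\<close> stands for the function with the same subscript.\<close>

primrec root_vec :: "int \<Rightarrow> nat \<Rightarrow> 'a::ring_1 zmat" where
  "root_vec i 0 = simple_root i"
| "root_vec i (Suc n) = mcommutator (root_vec i n) (simple_root (i + int (Suc n)))"


section \<open>The \<open>q\<close>-connection and its diagonalization\<close>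

definition g_fun :: "complex \<Rightarrow> (int \<Rightarrow> complex) \<Rightarrow> (int \<Rightarrow> complex poly) \<Rightarrow> int \<Rightarrow> ratfun" where
  "g_fun q \<zeta> Q i = rconst (\<zeta> i) * (qshift q (to_fract (Q i)) / to_fract (Q i))"

definition xi :: "(int \<Rightarrow> complex) \<Rightarrow> int \<Rightarrow> complex" where
  "xi \<zeta> i = \<zeta> i / \<zeta> (i - 1)"

definition rho :: "complex \<Rightarrow> (int \<Rightarrow> complex poly) \<Rightarrow> (int \<Rightarrow> complex poly) \<Rightarrow> int \<Rightarrow> ratfun" where
  "rho q \<Lambda> Q i = to_fract (\<Lambda> i) *
     (qshift q (to_fract (Q (i - 1))) * to_fract (Q (i + 1)) /
       (to_fract (Q i) * qshift q (to_fract (Q i))))"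

definition oper_factor ::
    "complex \<Rightarrow> (int \<Rightarrow> complex) \<Rightarrow> (int \<Rightarrow> complex poly) \<Rightarrow> (int \<Rightarrow> complex poly) \<Rightarrow> int \<Rightarrow> ratfun zmat" where
  "oper_factor q \<zeta> \<Lambda> Q i =
     coroot_power i (g_fun q \<zeta> Q i) \<star> mexp (mscale (to_fract (\<Lambda> i) / g_fun q \<zeta> Q i) (simple_root i))"

definition twist :: "(int \<Rightarrow> complex) \<Rightarrow> ratfun zmat" where
  "twist \<zeta> = coroot_prod (\<lambda>i. rconst (\<zeta> i))"

definition diagonalizes :: "complex \<Rightarrow> ratfun zmat \<Rightarrow> ratfun zmat \<Rightarrow> ratfun zmat \<Rightarrow> bool" where
  "diagonalizes q v Z A \<longleftrightarrow>
     (\<exists>w\<in>Bplus. v \<star> w = mone \<and> w \<star> v = mone \<and> A = mqshift q v \<star> Z \<star> w)"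

definition V_factor :: "(int \<Rightarrow> nat \<Rightarrow> ratfun) \<Rightarrow> int \<Rightarrow> ratfun zmat" where
  "V_factor \<phi> i = mexp (\<lambda>a b. - Sum_any (\<lambda>n. \<phi> i n * root_vec i n a b))"

text \<open>The relations as they follow from \<open>A(z) = v(qz) Z v(z)\<^sup>-\<^sup>1\<close> with \<open>Z\<close> having diagonal entries
  \<open>\<xi>\<^sub>i\<close>.  The version in print has the two \<open>\<xi>\<close>'s on the left exchanged and the
  unshifted \<open>\<phi>(z)\<close> instead of \<open>\<phi>(qz)\<close> on the right, which is incompatible with these
  conventions already in the entries \<open>(i, i + 1)\<close>, where \<open>A(z) v(z) = v(qz) Z\<close> reads
  \<open>\<rho>\<^sub>i(z) - \<xi>\<^sub>i \<phi>\<^sub>i(z) = - \<xi>\<^sub>i\<^sub>+\<^sub>1 \<phi>\<^sub>i(qz)\<close> after conjugation by the diagonal part of \<open>v\<close>.\<close>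

definition phi_relations ::
    "complex \<Rightarrow> (int \<Rightarrow> complex) \<Rightarrow> (int \<Rightarrow> complex poly) \<Rightarrow> (int \<Rightarrow> complex poly)
       \<Rightarrow> (int \<Rightarrow> nat \<Rightarrow> ratfun) \<Rightarrow> bool" where
  "phi_relations q \<zeta> \<Lambda> Q \<phi> \<longleftrightarrow>
     (\<forall>i. rconst (xi \<zeta> i) * \<phi> i 0 - rconst (xi \<zeta> (i + 1)) * qshift q (\<phi> i 0) = rho q \<Lambda> Q i) \<and>
     (\<forall>i. \<forall>j\<ge>1. rconst (xi \<zeta> i) * \<phi> i j - rconst (xi \<zeta> (i + int j + 1)) * qshift q (\<phi> i j)
        = rho q \<Lambda> Q (i + int j) * qshift q (\<phi> i (j - 1)))"


section \<open>The entries of the \<open>q\<close>-connection\<close>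


lemma mmult_eq_sum:
  assumes "finite S" "\<And>k. k \<notin> S \<Longrightarrow> M a k * N k b = 0"
  shows "(M \<star> N) a b = (\<Sum>k\<in>S. M a k * N k b)"
  unfolding mmult_def by (rule Sum_any.expand_superset) (use assms in auto)

lemma mdiag_mmult: "(mdiag d \<star> M) a b = d a * M a b"
  by (subst mmult_eq_sum[where S="{a}"]) (auto simp: mdiag_def)

lemma mmult_mone: "M \<star> mone = M"
  by (intro ext, subst mmult_eq_sum[where S="{b}" for b]) (auto simp: mdiag_def mone_def)

lemma mexp_simple:
  fixes c :: "'a::field"
  shows "mexp (mscale c (simple_root i)) =
    (\<lambda>a b. if a = b then 1 else if a = i \<and> b = i + 1 then c else 0)"
proof -
  let ?N = "mscale c (simple_root i) :: 'a zmat"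
  have N2: "?N \<star> ?N = (\<lambda>_ _. 0)"
    by (intro ext, subst mmult_eq_sum[where S="{}"]) (auto simp: mscale_def simple_root_def munit_def)
  have z: "M \<star> (\<lambda>_ _. 0) = (\<lambda>_ _. 0)" for M :: "'a zmat"
    by (intro ext, subst mmult_eq_sum[where S="{}"]) auto
  have p: "mpow ?N (Suc (Suc n)) = (\<lambda>_ _. 0)" for n
  proof (induction n)
    case 0 show ?case by (simp add: mmult_mone N2)
  next
    case (Suc n) then show ?case by (metis mpow.simps(2) z)
  qed
  have p': "mpow ?N n a b = 0" if "n \<notin> {0,1}" for n a b
    using p[of "n - 2"] that
    by (cases n; cases "n - 1") (auto simp del: mpow.simps)
  have sub: "{n. mpow ?N n a b / of_nat (fact n) \<noteq> 0} \<subseteq> {0, 1}" for a b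
  proof
    fix n assume "n \<in> {n. mpow ?N n a b / of_nat (fact n) \<noteq> 0}"
    then have "mpow ?N n a b \<noteq> 0" by auto
    then show "n \<in> {0, 1}" using p' by blast
  qed
  have "mexp ?N a b = (\<Sum>n\<in>{0,1}. mpow ?N n a b / of_nat (fact n))" for a b
    unfolding mexp_def by (rule Sum_any.expand_superset[OF _ sub]) simp
  then have "mexp ?N a b = mone a b + ?N a b" for a b
    by (simp add: mmult_mone)
  then show ?thesis
    by (intro ext) (auto simp: mone_def mdiag_def mscale_def simple_root_def munit_def)
qed

lemma oper_factor_mmult:
  assumes "g_fun q \<zeta> Q i \<noteq> 0"
  shows "(oper_factor q \<zeta> \<Lambda> Q i \<star> M) a b =
    (if a = i then g_fun q \<zeta> Q i * M i b + to_fract (\<Lambda> i) * M (i+1) b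
     else if a = i + 1 then inverse (g_fun q \<zeta> Q i) * M a b else M a b)"
  by (subst mmult_eq_sum[where S="{a,a+1}"])
    (use assms in \<open>auto simp: oper_factor_def coroot_power_def mdiag_mmult mexp_simple\<close>)

lemma upto_step: "rev [m..m + int k] = (m + int k) # rev [m..m + int k - 1]"
  by (simp add: upto_rec2)

lemma mprod_oper_factor:
  assumes "\<And>i. g_fun q \<zeta> Q i \<noteq> 0"
  shows "mprod (map (oper_factor q \<zeta> \<Lambda> Q) (rev [m..m + int k - 1])) = 
    (\<lambda>a b. if a = b then
         (if m \<le> a \<and> a \<le> m + int k - 1 then g_fun q \<zeta> Q a else 1) *
         (if m \<le> a - 1 \<and> a - 1 \<le> m + int k - 1 then inverse (g_fun q \<zeta> Q (a - 1)) else 1)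
       else if b = a + 1 \<and> m \<le> a \<and> a \<le> m + int k - 1 then to_fract (\<Lambda> a) else 0)"
proof (induction k)
  case 0 show ?case by (auto simp: mprod_def mone_def mdiag_def fun_eq_iff)
next
  case (Suc k)
  have "mprod (map (oper_factor q \<zeta> \<Lambda> Q) (rev [m..m + int (Suc k) - 1])) =
   oper_factor q \<zeta> \<Lambda> Q (m+int k) \<star> mprod (map (oper_factor q \<zeta> \<Lambda> Q) (rev [m..m + int k - 1]))"
    using upto_step[of m k] by (simp add: mprod_def del: rev_map)
  then show ?case
    unfolding Suc.IH by (intro ext) (auto simp: oper_factor_mmult assms)
qed

lemma g_fun_nonzero:
  assumes "q \<noteq> 0" "\<zeta> i \<noteq> 0" "Q i \<noteq> 0"
  shows "g_fun q \<zeta> Q i \<noteq> 0"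
  using assms
  by (simp add: g_fun_def rconst_def to_fract_def qshift_Fract eq_fract Zero_fract_def pcompose_eq_0_iff)

lemma has_prod_decreasing_oper_factor:
  assumes "q \<noteq> 0" "\<And>i. \<zeta> i \<noteq> 0" "\<And>i. Q i \<noteq> 0"
  shows "has_prod_decreasing (oper_factor q \<zeta> \<Lambda> Q)
    (\<lambda>a b. if a = b then g_fun q \<zeta> Q a / g_fun q \<zeta> Q (a - 1)
      else if b = a + 1 then to_fract (\<Lambda> a) else 0)"
  unfolding has_prod_decreasing_def
proof (intro allI exI impI)
  have g: "g_fun q \<zeta> Q i \<noteq> 0" for i
    using assms by (simp add: g_fun_nonzero)
  fix a b m n :: int
  assume h: "m \<le> - (\<bar>a\<bar>+1) \<and> \<bar>a\<bar>+1 \<le> n"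
  then have "n = m + int (nat (n - m + 1)) - 1" using h by linarith
  then obtain k where n: "n = m + int k - 1" by blast
  show "mprod (map (oper_factor q \<zeta> \<Lambda> Q) (rev [m..n])) a b =
    (if a = b then g_fun q \<zeta> Q a / g_fun q \<zeta> Q (a - 1) else if b = a + 1 then to_fract (\<Lambda> a) else 0)"
    using h unfolding n mprod_oper_factor[OF g] by (auto simp: field_simps)
qed

end

(* The factors of the ordered product of the V_i are elementary: V_i differs from the identity only
   in row i.  Hence the product U is the inverse of the unitriangular matrix R whose entries above
   the diagonal are the functions phi themselves.  Writing the q-gauge equation for the inverse
   w = v^(-1), i.e. w(qz) A(z) = Z w(z), the bidiagonal form of A turns its entries directly into
   the q-difference relations.  For the converse, the diagonal entries of w(qz) A(z) = Z w(z) say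
   that the diagonal of w agrees with that of the inverse of the Q-part up to q-invariant rational
   functions, and these are constant because q is not a root of unity. *)

theory Submission
  imports Defs
begin

section \<open>Upper triangular matrices\<close>

definition upper :: "'a::zero zmat \<Rightarrow> bool" where
  "upper M \<longleftrightarrow> (\<forall>a b. b < a \<longrightarrow> M a b = 0)"

definition unitriangular :: "'a::zero_neq_one zmat \<Rightarrow> bool" where
  "unitriangular M \<longleftrightarrow> upper M \<and> (\<forall>a. M a a = 1)"

lemma upper_mdiag [simp]: "upper (mdiag d)"
  by (simp add: upper_def mdiag_def)

lemma upper_mone [simp]: "upper mone"
  by (simp add: mone_def)

lemma upper_Bplus: "M \<in> Bplus \<Longrightarrow> upper M"
  by (simp add: Bplus_def upper_def)

text \<open>The range may exceed \<open>{a..b}\<close>; this slack lets the nested sums in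
  \<open>mmult_assoc\<close> share one index interval.\<close>

lemma mmult_upper:
  assumes "upper M" "upper N" "a0 \<le> a" "b \<le> b0"
  shows "(M \<star> N) a b = (\<Sum>k\<in>{a0..b0}. M a k * N k b)"
proof (rule mmult_eq_sum)
  fix k assume "k \<notin> {a0..b0}"
  with assms(3,4) have "k < a \<or> b < k" by auto
  with assms(1,2) show "M a k * N k b = 0" by (auto simp: upper_def)
qed simp

lemma upper_mmult:
  assumes "upper M" "upper N"
  shows "upper (M \<star> N)"
  using assms by (auto simp: upper_def mmult_upper[OF assms order_refl order_refl])

text \<open>\<open>Sum_any\<close> defaults to 0 on infinite support, so the usual exchange of sums
  needs finiteness; upper triangularity confines every index to \<open>{a..b}\<close>.\<close>

lemma mmult_assoc:
  assumes "upper M" "upper N" "upper P"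
  shows "M \<star> N \<star> P = M \<star> (N \<star> P)"
proof (intro ext)
  fix a b
  have "(M \<star> N \<star> P) a b = (\<Sum>k\<in>{a..b}. (M \<star> N) a k * P k b)"
    using assms by (simp add: mmult_upper upper_mmult)
  also have "\<dots> = (\<Sum>k\<in>{a..b}. (\<Sum>l\<in>{a..b}. M a l * N l k) * P k b)"
    using assms by (intro sum.cong refl arg_cong2[where f="(*)"] mmult_upper) auto
  also have "\<dots> = (\<Sum>l\<in>{a..b}. M a l * (\<Sum>k\<in>{a..b}. N l k * P k b))"
    unfolding sum_distrib_left sum_distrib_right mult.assoc by (rule sum.swap)
  also have "\<dots> = (\<Sum>l\<in>{a..b}. M a l * (N \<star> P) l b)"
    using assms by (intro sum.cong refl arg_cong2[where f="(*)"] mmult_upper[symmetric]) auto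
  also have "\<dots> = (M \<star> (N \<star> P)) a b"
    using assms by (intro mmult_upper[symmetric] upper_mmult) auto
  finally show "(M \<star> N \<star> P) a b = (M \<star> (N \<star> P)) a b" .
qed

lemma mmult_mdiag: "(M \<star> mdiag d) a b = M a b * d b"
  by (subst mmult_eq_sum[where S="{b}"]) (auto simp: mdiag_def)

lemma mone_mmult: "mone \<star> M = M"
  by (intro ext) (simp add: mone_def mdiag_mmult)

lemma mexp_square_zero:
  assumes "N \<star> N = (\<lambda>_ _. 0)"
  shows "mexp N = (\<lambda>a b. mone a b + N a b)"
proof (intro ext)
  fix a b
  have pow: "mpow N n = (\<lambda>_ _. 0)" if "n \<ge> 2" for n
    using that
  proof (induction n rule: nat_induct_at_least)
    case base
    then show ?case by (simp add: numeral_2_eq_2 mmult_mone assms)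
  next
    case (Suc n)
    then show ?case by (simp add: mmult_def)
  qed
  have "mexp N a b = (\<Sum>n\<in>{0, 1}. mpow N n a b / of_nat (fact n))"
    unfolding mexp_def
  proof (rule Sum_any.expand_superset)
    show "{n. mpow N n a b / of_nat (fact n) \<noteq> 0} \<subseteq> {0, 1}"
    proof
      fix n assume "n \<in> {n. mpow N n a b / of_nat (fact n) \<noteq> 0}"
      then have "mpow N n \<noteq> (\<lambda>_ _. 0)" by auto
      then have "\<not> n \<ge> 2" using pow by blast
      then show "n \<in> {0, 1}" by auto
    qed
  qed simp
  then show "mexp N a b = mone a b + N a b"
    by (simp add: mmult_mone)
qed

section \<open>Rational functions and the \<open>q\<close>-shift\<close>

lemma pcompose_q_nonzero: "q \<noteq> 0 \<Longrightarrow> p \<noteq> 0 \<Longrightarrow> pcompose p [:0, q:] \<noteq> (0 :: complex poly)"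
  by (simp add: pcompose_eq_0_iff)

lemma qshift_to_fract: "q \<noteq> 0 \<Longrightarrow> qshift q (to_fract p) = to_fract (pcompose p [:0, q:])"
  by (simp add: to_fract_def qshift_Fract pcompose_1)

lemma qshift_rconst [simp]: "q \<noteq> 0 \<Longrightarrow> qshift q (rconst c) = rconst c"
  by (simp add: rconst_def qshift_to_fract pcompose_pCons)

lemma rconst_0 [simp]: "rconst 0 = 0"
  by (simp add: rconst_def)

lemma rconst_1 [simp]: "rconst 1 = 1"
  by (simp add: rconst_def flip: one_pCons)

lemma rconst_eq_0_iff [simp]: "rconst c = 0 \<longleftrightarrow> c = 0"
  by (simp add: rconst_def)

lemma rconst_mult: "rconst (a * b) = rconst a * rconst b"
  by (simp add: rconst_def flip: to_fract_mult)

lemma rconst_divide: "rconst (a / b) = rconst a / rconst b"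
proof (cases "b = 0")
  case False
  have "rconst (a / b) * rconst b = rconst a"
    using False by (simp flip: rconst_mult)
  then show ?thesis using False by (simp add: field_simps)
qed simp

lemma qshift_0 [simp]: "q \<noteq> 0 \<Longrightarrow> qshift q 0 = 0"
  using qshift_rconst[of q 0] by simp

lemma qshift_1 [simp]: "q \<noteq> 0 \<Longrightarrow> qshift q 1 = 1"
  using qshift_rconst[of q 1] by simp

lemma qshift_add: "q \<noteq> 0 \<Longrightarrow> qshift q (f + g) = qshift q f + qshift q g"
  by (cases f; cases g)
    (simp add: qshift_Fract add_fract pcompose_q_nonzero pcompose_add pcompose_mult)

lemma qshift_mult: "q \<noteq> 0 \<Longrightarrow> qshift q (f * g) = qshift q f * qshift q g"
  by (cases f; cases g) (simp add: qshift_Fract mult_fract pcompose_mult)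

lemma qshift_sum: "q \<noteq> 0 \<Longrightarrow> qshift q (sum f S) = (\<Sum>x\<in>S. qshift q (f x))"
  by (induction S rule: infinite_finite_induct) (simp_all add: qshift_add)

lemma qshift_inverse:
  assumes "q \<noteq> 0"
  shows "qshift q (inverse f) = inverse (qshift q f)"
proof (cases "f = 0")
  case False
  then have "qshift q (inverse f) * qshift q f = 1"
    using assms by (simp flip: qshift_mult)
  then show ?thesis by (metis inverse_unique mult.commute)
qed (use assms in simp)

lemma qshift_divide: "q \<noteq> 0 \<Longrightarrow> qshift q (f / g) = qshift q f / qshift q g"
  by (simp add: divide_inverse qshift_mult qshift_inverse)

text \<open>For f = a/b, invariance makes the ratio constant along the points \<open>q ^ n\<close>.
  These are pairwise distinct, so a polynomial a - c b vanishing at almost all of them is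
  zero.\<close>

lemma qshift_fixed_imp_const:
  assumes "q \<noteq> 0" and root: "\<And>n::nat. n > 0 \<Longrightarrow> q ^ n \<noteq> 1" and fixed: "qshift q f = f"
  shows "\<exists>c. f = rconst c"
proof -
  obtain a b where f: "f = Fract a b" and b: "b \<noteq> 0"
    by (cases f)
  have eq: "pcompose a [:0, q:] * b = a * pcompose b [:0, q:]"
    using fixed b assms(1) by (simp add: f qshift_Fract eq_fract pcompose_q_nonzero)
  have inj: "inj (\<lambda>n. q ^ n)"
  proof (rule linorder_injI)
    fix m n :: nat assume "m < n"
    then have "q ^ n = q ^ m * q ^ (n - m)" by (simp flip: power_add)
    moreover have "q ^ (n - m) \<noteq> 1" using \<open>m < n\<close> by (intro root) simp
    ultimately show "q ^ m \<noteq> q ^ n" using assms(1) by auto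
  qed
  have "finite {n. poly b (q ^ n) = 0}"
    using finite_vimageI[OF poly_roots_finite[OF b] inj] by (simp add: vimage_def)
  then obtain N where N: "poly b (q ^ n) \<noteq> 0" if "n \<ge> N" for n
    by (metis (mono_tags, lifting) finite_nat_set_iff_bounded mem_Collect_eq not_less)
  \<comment> \<open>The denominator may vanish at some early powers of q; c is the value of f at a
    point of the orbit from which on it does not.\<close>
  define c where "c = poly a (q ^ N) / poly b (q ^ N)"
  have c: "poly a (q ^ n) = c * poly b (q ^ n)" if "n \<ge> N" for n
    using that
  proof (induction n rule: nat_induct_at_least)
    case base
    show ?case using N[of N] by (simp add: c_def)
  next
    case (Suc n)
    have "poly a (q ^ Suc n) * poly b (q ^ n) = poly a (q ^ n) * poly b (q ^ Suc n)"
      using arg_cong[OF eq, of "\<lambda>p. poly p (q ^ n)"] by (simp add: poly_pcompose mult.commute)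
    then show ?case using Suc N[of n] by simp
  qed
  have "a - smult c b = 0"
  proof (rule ccontr)
    assume "a - smult c b \<noteq> 0"
    then have "finite {n. poly (a - smult c b) (q ^ n) = 0}"
      using finite_vimageI[OF poly_roots_finite inj, of "a - smult c b"] by (simp add: vimage_def)
    moreover have "{N..} \<subseteq> {n. poly (a - smult c b) (q ^ n) = 0}"
      using c by auto
    ultimately show False using finite_subset infinite_Ici by blast
  qed
  then have "f = rconst c"
    using b by (simp add: f rconst_def to_fract_def eq_fract)
  then show ?thesis ..
qed

lemma upper_mqshift: "q \<noteq> 0 \<Longrightarrow> upper M \<Longrightarrow> upper (mqshift q M)"
  by (simp add: upper_def mqshift_def)

lemma mqshift_mone: "q \<noteq> 0 \<Longrightarrow> mqshift q mone = mone"
  by (intro ext) (simp add: mqshift_def mone_def mdiag_def)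

lemma mqshift_mmult:
  assumes "q \<noteq> 0" "upper M" "upper N"
  shows "mqshift q (M \<star> N) = mqshift q M \<star> mqshift q N"
proof (intro ext)
  fix a b
  show "mqshift q (M \<star> N) a b = (mqshift q M \<star> mqshift q N) a b"
    unfolding mmult_upper[OF upper_mqshift[OF assms(1,2)] upper_mqshift[OF assms(1,3)]
        order_refl order_refl]
    by (simp add: mqshift_def mmult_upper[OF assms(2,3) order_refl order_refl]
        qshift_sum qshift_mult assms(1))
qed

section \<open>The ordered product of the \<open>V\<^sub>i\<close>\<close>

text \<open>Only one of the two products in the commutator survives. A segment of
  \<open>n + 1\<close> simple roots starting at i ends in column \<open>i + n + 1\<close>.\<close>

lemma root_vec_munit: "root_vec i n = munit i (i + int n + 1)"
proof (induction n)
  case (Suc n)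
  show ?case
  proof (intro ext)
    fix a b
    have "(munit i (i + int n + 1) \<star> munit (i + int n + 1) (i + int n + 2)) a b
        = (munit i (i + int n + 2) a b :: 'a)"
      by (subst mmult_eq_sum[where S="{i + int n + 1}"]) (auto simp: munit_def)
    moreover have "(munit (i + int n + 1) (i + int n + 2) \<star> munit i (i + int n + 1)) a b = (0 :: 'a)"
      by (subst mmult_eq_sum[where S="{}"]) (auto simp: munit_def)
    ultimately show "root_vec i (Suc n) a b = (munit i (i + int (Suc n) + 1) a b :: 'a)"
      by (simp add: Suc.IH mcommutator_def simple_root_def algebra_simps)
  qed
qed (simp add: simple_root_def)

text \<open>Entry (a, b) above the diagonal carries the segment a, ..., b - 1, whose encoded length
  is \<open>b - a - 1\<close>. This matrix turns out to be the inverse of the product of the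
  V_i.\<close>

definition phi_matrix :: "(int \<Rightarrow> nat \<Rightarrow> 'a::zero_neq_one) \<Rightarrow> 'a zmat" where
  "phi_matrix \<phi> = (\<lambda>a b. if a = b then 1 else if a < b then \<phi> a (nat (b - a - 1)) else 0)"

lemma unitriangular_phi_matrix: "unitriangular (phi_matrix \<phi>)"
  by (simp add: unitriangular_def upper_def phi_matrix_def)

lemma V_factor_entry:
  "V_factor \<phi> i a b = mone a b + (if a = i \<and> i < b then - phi_matrix \<phi> a b else 0)"
proof -
  define N where "N = (\<lambda>a b. - Sum_any (\<lambda>n. \<phi> i n * root_vec i n a b))"
  have N: "N a b = (if a = i \<and> i < b then - phi_matrix \<phi> a b else 0)" for a b
  proof -
    \<comment> \<open>At most one segment starting at i ends in column b. For
      \<open>b \<le> i\<close> the truncation \<open>nat\<close> gives 0, and that summand vanishes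
      as well.\<close>
    have "Sum_any (\<lambda>n. \<phi> i n * root_vec i n a b)
        = (\<Sum>n\<in>{nat (b - i - 1)}. \<phi> i n * root_vec i n a b)"
      by (rule Sum_any.expand_superset) (auto simp: root_vec_munit munit_def)
    then show ?thesis
      by (auto simp: N_def root_vec_munit munit_def phi_matrix_def)
  qed
  \<comment> \<open>A non-zero summand would need its middle index to equal i as a row and to exceed
    i as a column.\<close>
  have "N \<star> N = (\<lambda>_ _. 0)"
    by (intro ext, subst mmult_eq_sum[where S="{}"]) (auto simp: N)
  then have "V_factor \<phi> i = (\<lambda>a b. mone a b + N a b)"
    unfolding V_factor_def N_def[symmetric] by (rule mexp_square_zero)
  then show ?thesis by (simp add: N)
qed

lemma unitriangular_V_factor: "unitriangular (V_factor \<phi> i)"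
  by (simp add: unitriangular_def upper_def V_factor_entry mone_def mdiag_def)

lemma unitriangular_mone: "unitriangular mone"
  by (simp add: unitriangular_def mone_def mdiag_def upper_def)

lemma unitriangular_mmult:
  assumes "unitriangular M" "unitriangular N"
  shows "unitriangular (M \<star> N)"
proof -
  have "(M \<star> N) a a = 1" for a
    using assms mmult_upper[of M N a a a a] by (simp add: unitriangular_def)
  then show ?thesis
    using assms upper_mmult by (auto simp: unitriangular_def)
qed

lemma mprod_Cons: "mprod (M # Ms) = M \<star> mprod Ms"
  by (simp add: mprod_def)

lemma unitriangular_mprod:
  "(\<And>M. M \<in> set Ms \<Longrightarrow> unitriangular M) \<Longrightarrow> unitriangular (mprod Ms)"
proof (induction Ms)
  case Nil
  then show ?case by (simp add: mprod_def unitriangular_mone)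
next
  case (Cons M Ms)
  then show ?case by (simp add: mprod_Cons unitriangular_mmult)
qed

text \<open>\<open>mprod\<close> folds from the right, so splitting off the last factor requires
  associativity, which triangularity supplies.\<close>

lemma mprod_snoc:
  assumes "\<And>M. M \<in> set (Ms @ [N]) \<Longrightarrow> unitriangular M"
  shows "mprod (Ms @ [N]) = mprod Ms \<star> N"
  using assms
proof (induction Ms)
  case Nil
  then show ?case by (simp add: mprod_def mmult_mone mone_mmult)
next
  case (Cons M Ms)
  have "unitriangular (mprod Ms)"
    using Cons.prems by (intro unitriangular_mprod) simp
  then have "upper M" "upper N" "upper (mprod Ms)"
    using Cons.prems by (simp_all add: unitriangular_def)
  then show ?case
    using Cons by (simp add: mprod_Cons mmult_assoc)
qed

section \<open>Finite partial products of the V_i and their stabilization\<close>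

definition V_segment :: "(int \<Rightarrow> nat \<Rightarrow> ratfun) \<Rightarrow> int \<Rightarrow> int \<Rightarrow> ratfun zmat" where
  "V_segment \<phi> m n = mprod (map (V_factor \<phi>) [m..n])"

lemma unitriangular_V_segment: "unitriangular (V_segment \<phi> m n)"
  unfolding V_segment_def by (intro unitriangular_mprod) (auto simp: unitriangular_V_factor)

lemma V_segment_left:
  "m \<le> n \<Longrightarrow> V_segment \<phi> m n = V_factor \<phi> m \<star> V_segment \<phi> (m + 1) n"
  by (simp add: V_segment_def upto_rec1 mprod_Cons)

lemma V_segment_right:
  assumes "m \<le> n"
  shows "V_segment \<phi> m n = V_segment \<phi> m (n - 1) \<star> V_factor \<phi> n"
  unfolding V_segment_def upto_rec2[OF assms] map_append list.map
  by (intro mprod_snoc) (auto simp: unitriangular_V_factor)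

text \<open>Row a of V_m is a row of the identity unless m = a, so multiplying by V_m on the left
  leaves row a alone.\<close>

lemma V_segment_drop_left:
  assumes "m \<le> n" "m \<noteq> a"
  shows "V_segment \<phi> m n a b = V_segment \<phi> (m + 1) n a b"
  unfolding V_segment_left[OF assms(1)]
  by (subst mmult_eq_sum[where S="{a}"]) (use assms in \<open>auto simp: V_factor_entry mone_def mdiag_def\<close>)

text \<open>The off-diagonal entries of V_n lie in columns beyond n, so column b of V_n is a column
  of the identity.\<close>

lemma V_segment_drop_right:
  assumes "m \<le> n" "b \<le> n"
  shows "V_segment \<phi> m n a b = V_segment \<phi> m (n - 1) a b"
  unfolding V_segment_right[OF assms(1)]
  by (subst mmult_eq_sum[where S="{b}"]) (use assms in \<open>auto simp: V_factor_entry mone_def mdiag_def\<close>)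

text \<open>The window of factors depends on the entry: those with index from a to b already
  determine entry (a, b) of the infinite product.\<close>

definition V_product :: "(int \<Rightarrow> nat \<Rightarrow> ratfun) \<Rightarrow> ratfun zmat" where
  "V_product \<phi> = (\<lambda>a b. V_segment \<phi> a b a b)"

text \<open>Factors beyond b are peeled off on the right, then factors before a on the left. Below
  the diagonal both sides vanish.\<close>

lemma V_segment_stable:
  assumes "m \<le> a" "b \<le> n"
  shows "V_segment \<phi> m n a b = V_product \<phi> a b"
proof (cases "a \<le> b")
  case True
  have "V_segment \<phi> m n a b = V_segment \<phi> m b a b"
    using assms(2)
  proof (induction n rule: int_ge_induct)
    case (step n)
    then show ?case
      using V_segment_drop_right[of m "n + 1" b \<phi> a] True assms(1) by simp
  qed simp
  also have "\<dots> = V_segment \<phi> a b a b"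
    using assms(1)
  proof (induction m rule: int_le_induct)
    case (step m)
    then show ?case
      using V_segment_drop_left[of "m - 1" b a \<phi> b] True by simp
  qed simp
  finally show ?thesis by (simp add: V_product_def)
next
  case False
  then show ?thesis
    using unitriangular_V_segment[of \<phi>] by (simp add: V_product_def unitriangular_def upper_def)
qed

lemma has_prod_increasing_V_product: "has_prod_increasing (V_factor \<phi>) (V_product \<phi>)"
  unfolding has_prod_increasing_def V_segment_def[symmetric]
proof (intro allI exI impI)
  fix a b m n :: int
  assume "m \<le> - (\<bar>a\<bar> + \<bar>b\<bar>) \<and> \<bar>a\<bar> + \<bar>b\<bar> \<le> n"
  then show "V_segment \<phi> m n a b = V_product \<phi> a b"
    by (intro V_segment_stable) auto
qed

lemma unitriangular_V_product: "unitriangular (V_product \<phi>)"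
  using unitriangular_V_segment[of \<phi>] by (simp add: V_product_def unitriangular_def upper_def)

lemma V_segment_outer_row:
  assumes "a < m"
  shows "V_segment \<phi> m n a b = mone a b"
  using assms
proof (induction "nat (n + 1 - m)" arbitrary: m)
  case 0
  then show ?case by (simp add: V_segment_def mprod_def)
next
  case (Suc k)
  then show ?case using V_segment_drop_left[of m n a \<phi> b] Suc.hyps(1)[of "m + 1"] by simp
qed

text \<open>Splitting off the leftmost relevant factor V_a expresses row a of the product as the
  identity row minus the \<phi>-weighted sum of the later rows. Moving that sum to the other side
  gives row a of the claim.\<close>

lemma phi_matrix_mmult_V_product: "phi_matrix \<phi> \<star> V_product \<phi> = mone"
proof (intro ext)
  fix a b
  have up: "upper (phi_matrix \<phi>)" "upper (V_product \<phi>)" "upper (V_factor \<phi> a)"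
    "upper (V_segment \<phi> (a + 1) b)"
    using unitriangular_phi_matrix unitriangular_V_product unitriangular_V_factor
      unitriangular_V_segment by (auto simp: unitriangular_def)
  show "(phi_matrix \<phi> \<star> V_product \<phi>) a b = mone a b"
  proof (cases "a \<le> b")
    case False
    then show ?thesis
      using upper_mmult[OF up(1,2)] upper_mone[where 'a=ratfun] by (simp add: upper_def)
  next
    case True
    then have I: "{a..b} = insert a {a+1..b}" by auto
    let ?S = "\<Sum>k\<in>{a+1..b}. phi_matrix \<phi> a k * V_product \<phi> k b"
    have "V_product \<phi> a b = (\<Sum>k\<in>{a..b}. V_factor \<phi> a a k * V_segment \<phi> (a + 1) b k b)"
      unfolding V_product_def V_segment_left[OF True] using up by (intro mmult_upper) auto
    also have "\<dots> = mone a b + (\<Sum>k\<in>{a+1..b}. V_factor \<phi> a a k * V_segment \<phi> (a + 1) b k b)"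
      unfolding I by (simp add: V_segment_outer_row V_factor_entry mone_def[where 'a=ratfun] mdiag_def)
    \<comment> \<open>For rows \<open>k \<ge> a + 1\<close> the window starting at
      \<open>a + 1\<close> is large enough for stability.\<close>
    also have "(\<Sum>k\<in>{a+1..b}. V_factor \<phi> a a k * V_segment \<phi> (a + 1) b k b) = - ?S"
      unfolding sum_negf[symmetric]
      by (intro sum.cong) (auto simp: V_segment_stable V_factor_entry mone_def mdiag_def)
    finally have "V_product \<phi> a b + ?S = mone a b" by simp
    moreover have "(phi_matrix \<phi> \<star> V_product \<phi>) a b = V_product \<phi> a b + ?S"
      unfolding mmult_upper[OF up(1,2) order_refl order_refl] I by (simp add: phi_matrix_def)
    ultimately show ?thesis by simp
  qed
qed

lemma phi_matrix_of_unitriangular: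
  assumes "unitriangular M"
  shows "phi_matrix (\<lambda>i n. M i (i + int n + 1)) = M"
  using assms by (auto simp: phi_matrix_def unitriangular_def upper_def fun_eq_iff)

text \<open>The product is unitriangular, hence itself a \<open>phi_matrix\<close> for some \<psi>,
  and so has a right inverse. Left and right inverses agree by associativity.\<close>

lemma V_product_mmult_phi_matrix: "V_product \<phi> \<star> phi_matrix \<phi> = mone"
proof -
  define \<psi> where "\<psi> = (\<lambda>i n. V_product \<phi> i (i + int n + 1))"
  have "phi_matrix \<psi> = V_product \<phi>"
    unfolding \<psi>_def by (rule phi_matrix_of_unitriangular[OF unitriangular_V_product])
  then have inv: "V_product \<phi> \<star> V_product \<psi> = mone"
    using phi_matrix_mmult_V_product[of \<psi>] by simp
  have up: "upper (phi_matrix \<phi>)" "upper (V_product \<phi>)" "upper (V_product \<psi>)"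
    using unitriangular_phi_matrix unitriangular_V_product by (auto simp: unitriangular_def)
  have "phi_matrix \<phi> = phi_matrix \<phi> \<star> (V_product \<phi> \<star> V_product \<psi>)"
    by (simp add: inv mmult_mone)
  also have "\<dots> = V_product \<psi>"
    using mmult_assoc[OF up] by (simp add: phi_matrix_mmult_V_product mone_mmult)
  finally show ?thesis using inv by simp
qed

section \<open>The gauge equation for the inverse\<close>

lemma mmult_inverse_unique:
  assumes "upper v" "upper w" "upper v'" "v \<star> w = mone" "w \<star> v' = mone"
  shows "v = v'"
  using mmult_assoc[OF assms(1-3)] assms(4,5) by (simp add: mmult_mone mone_mmult)

text \<open>Multiplying on the left by the shift of w or of v passes between the two equations,
  since the shift is multiplicative on upper triangular matrices. The second form is linear in
  w.\<close>

lemma gauge_inverse_iff: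
  assumes "q \<noteq> 0" "upper v" "upper w" "upper Z" "upper A" "v \<star> w = mone" "w \<star> v = mone"
  shows "A = mqshift q v \<star> Z \<star> w \<longleftrightarrow> mqshift q w \<star> A = Z \<star> w"
proof -
  note up = assms(2-5) upper_mqshift[OF assms(1,2)] upper_mqshift[OF assms(1,3)]
  have inv: "mqshift q v \<star> mqshift q w = mone" "mqshift q w \<star> mqshift q v = mone"
    using assms by (simp_all add: mqshift_mone flip: mqshift_mmult)
  have "mqshift q w \<star> (mqshift q v \<star> (Z \<star> w)) = Z \<star> w"
    using up by (simp add: inv mone_mmult upper_mmult flip: mmult_assoc)
  moreover have "mqshift q v \<star> (mqshift q w \<star> A) = A"
    using up by (simp add: inv mone_mmult upper_mmult flip: mmult_assoc)
  moreover have "mqshift q v \<star> Z \<star> w = mqshift q v \<star> (Z \<star> w)"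
    using up by (simp add: mmult_assoc)
  ultimately show ?thesis by metis
qed

text \<open>Inverses within \<open>Bplus\<close> are unique, so the existential inverse in
  \<open>diagonalizes\<close> can be replaced by a known one.\<close>

lemma diagonalizes_iff:
  assumes "q \<noteq> 0" "upper v" "w \<in> Bplus" "upper Z" "upper A" "v \<star> w = mone" "w \<star> v = mone"
  shows "diagonalizes q v Z A \<longleftrightarrow> mqshift q w \<star> A = Z \<star> w"
proof -
  have "w' = w" if "w' \<in> Bplus" "w' \<star> v = mone" for w'
    using mmult_inverse_unique[of w' v w] that assms upper_Bplus by blast
  then have "diagonalizes q v Z A \<longleftrightarrow> A = mqshift q v \<star> Z \<star> w"
    unfolding diagonalizes_def using assms(3,6,7) by blast
  then show ?thesis
    using gauge_inverse_iff assms upper_Bplus by blast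
qed

section \<open>The bidiagonal connection matrix and the relations as matrix entries\<close>

definition connection ::
    "complex \<Rightarrow> (int \<Rightarrow> complex) \<Rightarrow> (int \<Rightarrow> complex poly) \<Rightarrow> (int \<Rightarrow> complex poly) \<Rightarrow> ratfun zmat" where
  "connection q \<zeta> \<Lambda> Q = (\<lambda>a b. if a = b then g_fun q \<zeta> Q a / g_fun q \<zeta> Q (a - 1)
      else if b = a + 1 then to_fract (\<Lambda> a) else 0)"

lemma has_prod_decreasing_unique:
  assumes "has_prod_decreasing F P" "has_prod_decreasing F P'"
  shows "P = P'"
proof (intro ext)
  fix a b
  obtain K where K: "mprod (map F (rev [m..n])) a b = P a b" if "m \<le> - K" "K \<le> n" for m n
    using assms(1) unfolding has_prod_decreasing_def by blast
  obtain K' where K': "mprod (map F (rev [m..n])) a b = P' a b" if "m \<le> - K'" "K' \<le> n" for m n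
    using assms(2) unfolding has_prod_decreasing_def by blast
  show "P a b = P' a b"
    using K[of "- max K K'" "max K K'"] K'[of "- max K K'" "max K K'"] by simp
qed

lemma upper_connection: "upper (connection q \<zeta> \<Lambda> Q)"
  by (simp add: connection_def upper_def)

lemma mmult_connection:
  "(M \<star> connection q \<zeta> \<Lambda> Q) a b =
     M a b * (g_fun q \<zeta> Q b / g_fun q \<zeta> Q (b - 1)) + M a (b - 1) * to_fract (\<Lambda> (b - 1))"
  by (subst mmult_eq_sum[where S="{b, b - 1}"]) (auto simp: connection_def)

lemma twist_mmult: "(twist \<zeta> \<star> M) a b = rconst (xi \<zeta> a) * M a b"
  by (simp add: twist_def coroot_prod_def mdiag_mmult xi_def rconst_divide)

definition Q_diag :: "(int \<Rightarrow> complex poly) \<Rightarrow> int \<Rightarrow> ratfun" where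
  "Q_diag Q a = to_fract (Q a) / to_fract (Q (a - 1))"

text \<open>With 1 on the diagonal in place of the \<phi> of an empty segment, the first relation
  takes the same shape as the others. Entries on or below the diagonal hold trivially.\<close>

lemma phi_relations_iff_matrix:
  assumes "q \<noteq> 0"
  shows "phi_relations q \<zeta> \<Lambda> Q \<phi> \<longleftrightarrow>
    (\<forall>a b. rconst (xi \<zeta> b) * qshift q (phi_matrix \<phi> a b)
        + rho q \<Lambda> Q (b - 1) * qshift q (phi_matrix \<phi> a (b - 1))
      = rconst (xi \<zeta> a) * phi_matrix \<phi> a b)" (is "_ \<longleftrightarrow> (\<forall>a b. ?E a b)")
proof
  assume R: "phi_relations q \<zeta> \<Lambda> Q \<phi>"
  show "\<forall>a b. ?E a b"
  proof (intro allI)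
    fix a b :: int
    consider "b \<le> a" | "b = a + 1" | "b > a + 1" by linarith
    then show "?E a b"
    proof cases
      case 3
      define j where "j = nat (b - a - 1)"
      have j: "b = a + int j + 1" "j \<ge> 1" using 3 by (auto simp: j_def)
      have "nat (b - 1 - a - 1) = j - 1" using j by linarith
      moreover have "rconst (xi \<zeta> a) * \<phi> a j - rconst (xi \<zeta> (a + int j + 1)) * qshift q (\<phi> a j)
        = rho q \<Lambda> Q (a + int j) * qshift q (\<phi> a (j - 1))"
        using R j(2) unfolding phi_relations_def by blast
      ultimately show ?thesis using 3 assms j
        by (auto simp: phi_matrix_def algebra_simps)
    qed (use R assms in \<open>auto simp: phi_matrix_def phi_relations_def algebra_simps\<close>)
  qed
next
  assume E: "\<forall>a b. ?E a b"
  show "phi_relations q \<zeta> \<Lambda> Q \<phi>"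
    unfolding phi_relations_def
  proof (intro conjI allI impI)
    fix i
    show "rconst (xi \<zeta> i) * \<phi> i 0 - rconst (xi \<zeta> (i + 1)) * qshift q (\<phi> i 0) = rho q \<Lambda> Q i"
      using E[rule_format, of "i + 1" i] assms by (simp add: phi_matrix_def algebra_simps)
  next
    fix i and j :: nat assume j: "j \<ge> 1"
    have "nat (int j - 1) = j - 1" by linarith
    then show "rconst (xi \<zeta> i) * \<phi> i j - rconst (xi \<zeta> (i + int j + 1)) * qshift q (\<phi> i j)
        = rho q \<Lambda> Q (i + int j) * qshift q (\<phi> i (j - 1))"
      using E[rule_format, of "i + int j + 1" i] assms j by (simp add: phi_matrix_def algebra_simps)
  qed
qed

section \<open>Gauge transformations for fixed non-zero q, \<zeta> and Q\<close>

context
  fixes q :: complex and \<zeta> :: "int \<Rightarrow> complex" and \<Lambda> Q :: "int \<Rightarrow> complex poly"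
  assumes q: "q \<noteq> 0" and zeta: "\<And>i. \<zeta> i \<noteq> 0" and Q: "\<And>i. Q i \<noteq> 0"
begin

lemma Q_nonzero: "to_fract (Q i) \<noteq> 0" "qshift q (to_fract (Q i)) \<noteq> 0"
  using q Q by (simp_all add: qshift_to_fract pcompose_q_nonzero)

lemma Q_diag_nonzero: "Q_diag Q a \<noteq> 0"
  by (simp add: Q_diag_def Q)

lemma connection_diagonal:
  "g_fun q \<zeta> Q b / g_fun q \<zeta> Q (b - 1) = rconst (xi \<zeta> b) * qshift q (Q_diag Q b) / Q_diag Q b"
  using Q_nonzero zeta by (simp add: g_fun_def Q_diag_def xi_def rconst_divide qshift_divide q field_simps)

text \<open>This explains the shape of \<open>rho\<close>: it is what \<Lambda> becomes once the
  Q-part of the gauge transformation is stripped off.\<close>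

lemma connection_superdiagonal:
  "to_fract (\<Lambda> (b - 1)) / qshift q (Q_diag Q (b - 1)) = rho q \<Lambda> Q (b - 1) / Q_diag Q b"
  using Q_nonzero by (simp add: rho_def Q_diag_def qshift_divide q field_simps)

text \<open>Each entry of the gauge equation is the corresponding matrix form of a relation times
  \<open>rconst (k a) / Q_diag Q b\<close>. The scalars \<open>k a\<close> cancel because the shift
  fixes constants.\<close>

lemma gauge_iff_phi_relations:
  assumes k: "\<And>a. k a \<noteq> 0"
    and w: "\<And>a b. w a b = rconst (k a) * phi_matrix \<phi> a b / Q_diag Q b"
  shows "mqshift q w \<star> connection q \<zeta> \<Lambda> Q = twist \<zeta> \<star> w \<longleftrightarrow> phi_relations q \<zeta> \<Lambda> Q \<phi>"
proof -
  have d: "qshift q (Q_diag Q b) \<noteq> 0" for b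
    using Q_nonzero by (simp add: Q_diag_def qshift_divide q)
  have "(mqshift q w \<star> connection q \<zeta> \<Lambda> Q) a b = (twist \<zeta> \<star> w) a b \<longleftrightarrow>
    rconst (xi \<zeta> b) * qshift q (phi_matrix \<phi> a b)
        + rho q \<Lambda> Q (b - 1) * qshift q (phi_matrix \<phi> a (b - 1))
      = rconst (xi \<zeta> a) * phi_matrix \<phi> a b" (is "?L = ?R \<longleftrightarrow> ?l = ?r") for a b
  proof -
    have "?L = rconst (k a) * qshift q (phi_matrix \<phi> a b) / qshift q (Q_diag Q b)
          * (rconst (xi \<zeta> b) * qshift q (Q_diag Q b) / Q_diag Q b)
        + rconst (k a) * qshift q (phi_matrix \<phi> a (b - 1))
          * (to_fract (\<Lambda> (b - 1)) / qshift q (Q_diag Q (b - 1)))"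
      by (simp add: mmult_connection connection_diagonal mqshift_def w qshift_divide qshift_mult q)
    also have "\<dots> = rconst (k a) / Q_diag Q b * ?l"
      unfolding connection_superdiagonal using d Q_diag_nonzero by (simp add: field_simps)
    finally have L: "?L = rconst (k a) / Q_diag Q b * ?l" .
    have R: "?R = rconst (k a) / Q_diag Q b * ?r"
      by (simp add: twist_mmult w)
    show ?thesis unfolding L R using k Q_diag_nonzero by simp
  qed
  then show ?thesis
    unfolding phi_relations_iff_matrix[OF q] fun_eq_iff by simp
qed

text \<open>Diagonal factors pull out of the sums: the constants k cancel at the middle index in one
  product, the Q-part in the other. What remains is the mutual inverse pair
  \<open>V_product \<phi>\<close> and \<open>phi_matrix \<phi>\<close>.\<close>

lemma gauge_inverse:
  assumes k: "\<And>a. k a \<noteq> 0"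
    and w: "\<And>a b. w a b = rconst (k a) * phi_matrix \<phi> a b / Q_diag Q b"
    and v: "v = coroot_prod (\<lambda>i. to_fract (Q i)) \<star> V_product \<phi> \<star> mdiag (\<lambda>i. rconst (inverse (k i)))"
  shows "v \<in> Bplus" "w \<in> Bplus" "v \<star> w = mone" "w \<star> v = mone"
proof -
  have v': "v a b = Q_diag Q a * V_product \<phi> a b * rconst (inverse (k b))" for a b
    by (simp add: v mmult_mdiag coroot_prod_def mdiag_mmult Q_diag_def)
  have kk: "rconst (inverse (k a)) * rconst (k a) = 1" for a
    using k by (simp flip: rconst_mult)
  have un: "unitriangular (phi_matrix \<phi>)" "unitriangular (V_product \<phi>)"
    by (fact unitriangular_phi_matrix unitriangular_V_product)+
  then have up: "upper (phi_matrix \<phi>)" "upper (V_product \<phi>)"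
    by (simp_all add: unitriangular_def)
  show B: "v \<in> Bplus" "w \<in> Bplus"
    using un k Q_diag_nonzero by (simp_all add: Bplus_def v' w unitriangular_def upper_def)
  note upv = B[THEN upper_Bplus]
  show "v \<star> w = mone"
  proof (intro ext)
    fix a b
    have "v a l * w l b = Q_diag Q a / Q_diag Q b * (V_product \<phi> a l * phi_matrix \<phi> l b)" for l
    proof -
      have "v a l * w l b = Q_diag Q a / Q_diag Q b * (V_product \<phi> a l * phi_matrix \<phi> l b)
          * (rconst (inverse (k l)) * rconst (k l))"
        by (simp only: v' w divide_inverse ac_simps)
      then show ?thesis by (simp only: kk mult_1_right)
    qed
    then have "(v \<star> w) a b = Q_diag Q a / Q_diag Q b * (V_product \<phi> \<star> phi_matrix \<phi>) a b"
      by (simp add: mmult_upper[OF upv order_refl order_refl]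
          mmult_upper[OF up(2,1) order_refl order_refl] sum_distrib_left)
    then show "(v \<star> w) a b = mone a b"
      using Q_diag_nonzero by (simp add: V_product_mmult_phi_matrix mone_def mdiag_def)
  qed
  show "w \<star> v = mone"
  proof (intro ext)
    fix a b
    have "w a l * v l b
        = rconst (k a) * rconst (inverse (k b)) * (phi_matrix \<phi> a l * V_product \<phi> l b)" for l
      using Q_diag_nonzero[of l] by (simp add: v' w)
    then have "(w \<star> v) a b
        = rconst (k a) * rconst (inverse (k b)) * (phi_matrix \<phi> \<star> V_product \<phi>) a b"
      by (simp add: mmult_upper[OF upv(2,1) order_refl order_refl]
          mmult_upper[OF up order_refl order_refl] sum_distrib_left)
    then show "(w \<star> v) a b = mone a b"
      using kk[of b] by (simp add: phi_matrix_mmult_V_product mone_def mdiag_def mult.commute)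
  qed
qed

lemma upper_twist: "upper (twist \<zeta>)"
  by (simp add: twist_def coroot_prod_def)

lemma displayed_gauge:
  defines "D \<equiv> coroot_prod (\<lambda>i. to_fract (Q i))"
  shows "D \<star> V_product \<phi> \<in> Bplus"
    and "diagonalizes q (D \<star> V_product \<phi>) (twist \<zeta>) (connection q \<zeta> \<Lambda> Q)
      \<longleftrightarrow> phi_relations q \<zeta> \<Lambda> Q \<phi>"
proof -
  define w where "w = (\<lambda>a b. rconst 1 * phi_matrix \<phi> a b / Q_diag Q b)"
  \<comment> \<open>A trivial diagonal factor is appended so that \<open>gauge_inverse\<close>
    applies with all constants equal to 1.\<close>
  have v: "D \<star> V_product \<phi> = D \<star> V_product \<phi> \<star> mdiag (\<lambda>i. rconst (inverse 1))"
    by (simp add: mmult_mone flip: mone_def)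
  have w: "w a b = rconst 1 * phi_matrix \<phi> a b / Q_diag Q b" for a b
    by (simp add: w_def)
  note inv = gauge_inverse[of "\<lambda>_. 1" w \<phi>, OF one_neq_zero w v[unfolded D_def], folded D_def]
  show "D \<star> V_product \<phi> \<in> Bplus" by (rule inv)
  show "diagonalizes q (D \<star> V_product \<phi>) (twist \<zeta>) (connection q \<zeta> \<Lambda> Q)
      \<longleftrightarrow> phi_relations q \<zeta> \<Lambda> Q \<phi>"
    using diagonalizes_iff[OF q upper_Bplus[OF inv(1)] inv(2) upper_twist upper_connection inv(3,4)]
      gauge_iff_phi_relations[of "\<lambda>_. 1" w] by (simp add: w_def)
qed

text \<open>The constants c are a genuine freedom: a constant diagonal matrix commutes with the
  twist and is fixed by the shift.\<close>

lemma diagonalizing_form: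
  assumes root: "\<And>n::nat. n > 0 \<Longrightarrow> q ^ n \<noteq> 1"
    and diag: "diagonalizes q v (twist \<zeta>) (connection q \<zeta> \<Lambda> Q)" and vB: "v \<in> Bplus"
  obtains c \<phi> where "\<And>i. c i \<noteq> 0" "phi_relations q \<zeta> \<Lambda> Q \<phi>"
    "v = coroot_prod (\<lambda>i. to_fract (Q i)) \<star> V_product \<phi> \<star> mdiag (\<lambda>i. rconst (c i))"
proof -
  obtain w where w: "w \<in> Bplus" "v \<star> w = mone" "w \<star> v = mone"
    using diag unfolding diagonalizes_def by blast
  have eq: "mqshift q w \<star> connection q \<zeta> \<Lambda> Q = twist \<zeta> \<star> w"
    using diagonalizes_iff[OF q upper_Bplus[OF vB] w(1) upper_twist upper_connection w(2,3)] diag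
    by simp
  have "\<exists>k. w a a * Q_diag Q a = rconst k" for a
  proof (rule qshift_fixed_imp_const[OF q root])
    \<comment> \<open>This removes the superdiagonal of the connection from the diagonal entries of
      the equation.\<close>
    have "w a (a - 1) = 0" using w(1) by (simp add: Bplus_def)
    then have "qshift q (w a a) * (rconst (xi \<zeta> a) * qshift q (Q_diag Q a) / Q_diag Q a)
        = rconst (xi \<zeta> a) * w a a"
      using fun_cong[OF fun_cong[OF eq, of a], of a]
      by (simp add: mmult_connection connection_diagonal twist_mmult mqshift_def q)
    moreover have "xi \<zeta> a \<noteq> 0" by (simp add: xi_def zeta)
    ultimately show "qshift q (w a a * Q_diag Q a) = w a a * Q_diag Q a"
      using Q_diag_nonzero[of a] by (simp add: qshift_mult q field_simps)
  qed
  then obtain k where k: "w a a * Q_diag Q a = rconst (k a)" for a by metis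
  have k0: "k a \<noteq> 0" for a
  proof -
    have "rconst (k a) \<noteq> 0"
      unfolding k[symmetric] using w(1) Q_diag_nonzero[of a] by (simp add: Bplus_def)
    then show ?thesis by simp
  qed
  \<comment> \<open>Dividing out the constants and the Q-part normalizes w to diagonal 1; the \<phi>
    are then read off above the diagonal.\<close>
  define M where "M = (\<lambda>a b. w a b * Q_diag Q b / rconst (k a))"
  define \<phi> where "\<phi> = (\<lambda>i n. M i (i + int n + 1))"
  have "unitriangular M"
    using w(1) k0 by (simp add: unitriangular_def upper_def M_def k Bplus_def)
  then have "phi_matrix \<phi> = M"
    unfolding \<phi>_def by (rule phi_matrix_of_unitriangular)
  then have wM: "w a b = rconst (k a) * phi_matrix \<phi> a b / Q_diag Q b" for a b
    using k0 Q_diag_nonzero by (simp add: M_def)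
  let ?v = "coroot_prod (\<lambda>i. to_fract (Q i)) \<star> V_product \<phi> \<star> mdiag (\<lambda>i. rconst (inverse (k i)))"
  note inv = gauge_inverse[of k, OF k0 wM refl]
  \<comment> \<open>Both are inverse to the same w.\<close>
  have "v = ?v"
    by (rule mmult_inverse_unique[OF upper_Bplus[OF vB] upper_Bplus[OF w(1)] upper_Bplus[OF inv(1)]
          w(2) inv(4)])
  moreover have "phi_relations q \<zeta> \<Lambda> Q \<phi>"
    using gauge_iff_phi_relations[of k, OF k0 wM] eq by simp
  ultimately show thesis
    using that[of "\<lambda>i. inverse (k i)" \<phi>] k0 by simp
qed

end

theorem theorem9p10:
  fixes q :: complex
    and \<zeta> :: "int \<Rightarrow> complex"
    and \<Lambda> Q :: "int \<Rightarrow> complex poly"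
    and A :: "ratfun zmat"
  assumes "q \<noteq> 0"
    and "\<And>n::nat. n > 0 \<Longrightarrow> q ^ n \<noteq> 1"
    and "\<And>i. degree (\<Lambda> i) > 0"
    and "\<And>x. x islimpt (\<Union>i. {w. poly (\<Lambda> i) w = 0}) \<Longrightarrow> x = 0"
    and "\<And>i. lead_coeff (Q i) = 1"
    and "\<And>i. \<zeta> i \<noteq> 0"
    and "\<And>i (k::int). xi \<zeta> i / xi \<zeta> (i + 1) \<noteq> q powi k"
    and "has_prod_decreasing (oper_factor q \<zeta> \<Lambda> Q) A"
  shows
    \<comment> \<open>the displayed \<open>v\<close>, built from polynomials \<open>Q\<^sup>-\<close>, diagonalizes \<open>A\<close> iff the relations hold\<close>
    "(\<forall>Qm :: int \<Rightarrow> nat \<Rightarrow> complex poly.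
        let \<phi> = (\<lambda>i n. to_fract (Qm i n) / to_fract (Q (i + int n))) in
        \<exists>U. has_prod_increasing (V_factor \<phi>) U \<and>
            coroot_prod (\<lambda>i. to_fract (Q i)) \<star> U \<in> Bplus \<and>
            (diagonalizes q (coroot_prod (\<lambda>i. to_fract (Q i)) \<star> U) (twist \<zeta>) A
              \<longleftrightarrow> phi_relations q \<zeta> \<Lambda> Q \<phi>))
     \<and>
     \<comment> \<open>every diagonalizing \<open>v\<close> is of this form, up to a constant diagonal matrix on the right\<close>
     (\<forall>v\<in>Bplus. diagonalizes q v (twist \<zeta>) A \<longrightarrow>
        (\<exists>(c :: int \<Rightarrow> complex) (\<phi> :: int \<Rightarrow> nat \<Rightarrow> ratfun) U.
            (\<forall>i. c i \<noteq> 0) \<and> has_prod_increasing (V_factor \<phi>) U \<and>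
            v = coroot_prod (\<lambda>i. to_fract (Q i)) \<star> U \<star> mdiag (\<lambda>i. rconst (c i)) \<and>
            phi_relations q \<zeta> \<Lambda> Q \<phi>))"
proof -
  have Q: "Q i \<noteq> 0" for i
    using assms(5)[of i] by auto
  \<comment> \<open>The matrix A is given only as an entrywise limit of finite products; uniqueness
    of that limit makes it bidiagonal.\<close>
  have A: "A = connection q \<zeta> \<Lambda> Q"
    using has_prod_decreasing_unique[OF assms(8) has_prod_decreasing_oper_factor[OF assms(1,6) Q]]
    by (simp add: connection_def)
  show ?thesis
    unfolding A Let_def
  proof (intro conjI allI ballI impI)
    fix Qm :: "int \<Rightarrow> nat \<Rightarrow> complex poly"
    let ?\<phi> = "\<lambda>i n. to_fract (Qm i n) / to_fract (Q (i + int n))"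
    show "\<exists>U. has_prod_increasing (V_factor ?\<phi>) U \<and>
        coroot_prod (\<lambda>i. to_fract (Q i)) \<star> U \<in> Bplus \<and>
        (diagonalizes q (coroot_prod (\<lambda>i. to_fract (Q i)) \<star> U) (twist \<zeta>) (connection q \<zeta> \<Lambda> Q)
          \<longleftrightarrow> phi_relations q \<zeta> \<Lambda> Q ?\<phi>)"
      using has_prod_increasing_V_product displayed_gauge[OF assms(1), of \<zeta> Q, OF assms(6) Q] by blast
  next
    fix v assume "v \<in> Bplus" "diagonalizes q v (twist \<zeta>) (connection q \<zeta> \<Lambda> Q)"
    then obtain c \<phi> where "\<And>i. c i \<noteq> 0" "phi_relations q \<zeta> \<Lambda> Q \<phi>"
      "v = coroot_prod (\<lambda>i. to_fract (Q i)) \<star> V_product \<phi> \<star> mdiag (\<lambda>i. rconst (c i))"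
      using diagonalizing_form[OF assms(1), of \<zeta> Q, OF assms(6) Q assms(2)] by blast
    then show "\<exists>(c :: int \<Rightarrow> complex) (\<phi> :: int \<Rightarrow> nat \<Rightarrow> ratfun) U.
        (\<forall>i. c i \<noteq> 0) \<and> has_prod_increasing (V_factor \<phi>) U \<and>
        v = coroot_prod (\<lambda>i. to_fract (Q i)) \<star> U \<star> mdiag (\<lambda>i. rconst (c i)) \<and>
        phi_relations q \<zeta> \<Lambda> Q \<phi>"
      using has_prod_increasing_V_product by blast
  qed
qed

end
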